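(* The acyclic polynomial $A(G,x)$ is not an EE-invariant, and hence is not an evaluation (i.e. substitution instance) of the Tutte polynomial or of the matching polynomial. That is, for every commutative ring $\mathcal{R}$ containing $\mathbb{Z}[x]$: the graph parameter $G\mapsto A(G,x)\in\mathcal{R}$ is not an EE-invariant; there are no $p,q\in\mathcal{R}$ with $A(G,x)=T(G;p,q)$ for all graphs $G$; and there are no $w_1,w_2\in\mathcal{R}$ with $A(G,x)=M(G;w_1,w_2)$ for all graphs $G$.
   Context: Graphs are finite and undirected; contraction may create loops and multiple edges, a loop being a cycle of length $1$ and a pair of parallel edges a cycle of length $2$. The acyclic polynomial of a graph $G$ is $A(G,x)=\sum_{i\ge 0} a_i x^i$, where $a_i=|\{S\subseteq V(G): |S|=i \text{ and } G[S] \text{ is acyclic}\}|$ and $G[S]$ is the subgraph of $G$ induced by $S$ (acyclic means containing no cycle; the empty set is acyclic). For an edge $e$ of $G$, $G_{-e}$, $G_{/e}$ and $G_{\dagger e}$ denote deletion, contraction and extraction of $e$; contracting a loop means deleting it, and extraction means removing the endpoints of $e$ together with all incident edges. A graph parameter $F$ with values in a ring $\mathcal{R}$ is an EE-invariant if there exist $\alpha,\beta,\gamma\in\mathcal{R}$ such that for every graph $G$ and every $e\in E(G)$, $F(G)=F(G_{-e})+\alpha F(G_{/e})+\beta F(G_{\dagger e})$, with the additional conditions $F(\emptyset)=1$ (for the graph with no vertices), $F(K_1)=\gamma$, and $F(G\cup H)=F(G)F(H)$ for disjoint unions. $T(G;x,y)=\sum_{B\subseteq E(G)}(x-1)^{c(B)-c(E(G))}(y-1)^{|B|+c(B)-|V(G)|}$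 is the Tutte polynomial, where $c(B)$ is the number of connected components of $(V(G),B)$. $M(G;w_1,w_2)=\sum_{k\ge0} m_k\, w_1^{|V(G)|-2k}w_2^{k}$ is the (bivariate) matching polynomial, where $m_k$ is the number of matchings of $G$ with $k$ edges. *)

theory Defs
  imports "HOL-Computational_Algebra.Polynomial"
begin

text \<open>
  Finite undirected graphs, with loops and multiple edges.  An edge is an abstract label, and
  \<^term>\<open>ends G e\<close> is the set of its endpoints: a singleton if \<^term>\<open>e\<close> is a loop.  The value
  of \<^term>\<open>ends G\<close> on labels outside the edge set is irrelevant.
\<close>

record ('v, 'e) mgraph =
  verts :: "'v set"
  edges :: "'e set"
  ends :: "'e \<Rightarrow> 'v set"

definition graph :: "('v, 'e) mgraph \<Rightarrow> bool" where
  "graph G \<longleftrightarrow> finite (verts G) \<and> finite (edges G) \<and>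
     (\<forall>e \<in> edges G. ends G e \<subseteq> verts G \<and> card (ends G e) \<in> {1, 2})"

definition graph_iso :: "('v, 'e) mgraph \<Rightarrow> ('v, 'e) mgraph \<Rightarrow> bool" where
  "graph_iso G H \<longleftrightarrow> (\<exists>f g. bij_betw f (verts G) (verts H) \<and> bij_betw g (edges G) (edges H) \<and>
     (\<forall>e \<in> edges G. ends H (g e) = f ` ends G e))"

definition induced :: "('v, 'e) mgraph \<Rightarrow> 'v set \<Rightarrow> ('v, 'e) mgraph" where
  "induced G S = \<lparr>verts = verts G \<inter> S, edges = {e \<in> edges G. ends G e \<subseteq> S}, ends = ends G\<rparr>"

definition delete_edge :: "('v, 'e) mgraph \<Rightarrow> 'e \<Rightarrow> ('v, 'e) mgraph" where
  "delete_edge G e = \<lparr>verts = verts G, edges = edges G - {e}, ends = ends G\<rparr>"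

text \<open>
  The endpoints of the contracted edge are both identified with the smaller one; any other name
  for the merged vertex gives an isomorphic graph.  For a loop this is deletion, see
  \<open>contract_loop\<close> below.
\<close>

definition contract_edge :: "('v::linorder, 'e) mgraph \<Rightarrow> 'e \<Rightarrow> ('v, 'e) mgraph" where
  "contract_edge G e = (let h = (\<lambda>v. if v \<in> ends G e then Min (ends G e) else v) in
     \<lparr>verts = h ` verts G, edges = edges G - {e}, ends = (\<lambda>d. h ` ends G d)\<rparr>)"

definition extract_edge :: "('v, 'e) mgraph \<Rightarrow> 'e \<Rightarrow> ('v, 'e) mgraph" where
  "extract_edge G e =
     \<lparr>verts = verts G - ends G e, edges = {d \<in> edges G. ends G d \<inter> ends G e = {}}, ends = ends G\<rparr>"

definition disjoint_graphs :: "('v, 'e) mgraph \<Rightarrow> ('v, 'e) mgraph \<Rightarrow> bool" where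
  "disjoint_graphs G H \<longleftrightarrow> verts G \<inter> verts H = {} \<and> edges G \<inter> edges H = {}"

definition graph_union :: "('v, 'e) mgraph \<Rightarrow> ('v, 'e) mgraph \<Rightarrow> ('v, 'e) mgraph" where
  "graph_union G H = \<lparr>verts = verts G \<union> verts H, edges = edges G \<union> edges H,
     ends = (\<lambda>e. if e \<in> edges G then ends G e else ends H e)\<rparr>"

text \<open>
  The \<open>i\<close>-th edge joins the \<open>i\<close>-th vertex to the cyclically next one.  For length 1 it is a
  loop, and for length 2 distinctness of the edges leaves exactly the pairs of parallel edges.
\<close>

definition is_cycle :: "('v, 'e) mgraph \<Rightarrow> 'v list \<Rightarrow> 'e list \<Rightarrow> bool" where
  "is_cycle G vs es \<longleftrightarrow> vs \<noteq> [] \<and> length es = length vs \<and> distinct vs \<and> distinct es \<and>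
     set vs \<subseteq> verts G \<and> set es \<subseteq> edges G \<and>
     (\<forall>i < length vs. ends G (es ! i) = {vs ! i, vs ! (Suc i mod length vs)})"

definition acyclic_graph :: "('v, 'e) mgraph \<Rightarrow> bool" where
  "acyclic_graph G \<longleftrightarrow> \<not> (\<exists>vs es. is_cycle G vs es)"

definition acyclic_sets :: "('v, 'e) mgraph \<Rightarrow> nat \<Rightarrow> 'v set set" where
  "acyclic_sets G i = {S. S \<subseteq> verts G \<and> card S = i \<and> acyclic_graph (induced G S)}"

definition acyclic_poly :: "('v, 'e) mgraph \<Rightarrow> int poly" where
  "acyclic_poly G = (\<Sum>i \<le> card (verts G). monom (int (card (acyclic_sets G i))) i)"

text \<open>
  Graph parameters are functions on graphs whose vertices and edges are labelled by natural
  numbers, invariant under isomorphism; every finite graph is isomorphic to a graph of this kind,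
  and every two graphs have disjoint isomorphic copies.
\<close>

definition graph_parameter :: "((nat, nat) mgraph \<Rightarrow> 'a) \<Rightarrow> bool" where
  "graph_parameter F \<longleftrightarrow> (\<forall>G H. graph G \<longrightarrow> graph H \<longrightarrow> graph_iso G H \<longrightarrow> F G = F H)"

definition EE_invariant :: "((nat, nat) mgraph \<Rightarrow> 'a::comm_ring_1) \<Rightarrow> bool" where
  "EE_invariant F \<longleftrightarrow> graph_parameter F \<and> (\<exists>\<alpha> \<beta> \<gamma>.
     (\<forall>G e. graph G \<longrightarrow> e \<in> edges G \<longrightarrow>
        F G = F (delete_edge G e) + \<alpha> * F (contract_edge G e) + \<beta> * F (extract_edge G e)) \<and>
     (\<forall>G. graph G \<longrightarrow> verts G = {} \<longrightarrow> F G = 1) \<and>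
     (\<forall>G. graph G \<longrightarrow> card (verts G) = 1 \<longrightarrow> edges G = {} \<longrightarrow> F G = \<gamma>) \<and>
     (\<forall>G H. graph G \<longrightarrow> graph H \<longrightarrow> disjoint_graphs G H \<longrightarrow> F (graph_union G H) = F G * F H))"

text \<open>The number of connected components of the spanning subgraph with edge set \<open>B\<close>.\<close>

definition connected_rel :: "('v, 'e) mgraph \<Rightarrow> 'e set \<Rightarrow> ('v \<times> 'v) set" where
  "connected_rel G B = {(u, v). \<exists>e \<in> B. ends G e = {u, v}}\<^sup>* \<inter> verts G \<times> verts G"

definition num_components :: "('v, 'e) mgraph \<Rightarrow> 'e set \<Rightarrow> nat" where
  "num_components G B = card (verts G // connected_rel G B)"

text \<open>
  The Tutte and matching polynomials, evaluated at elements of a commutative ring.  For graphs, the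
  subtractions of natural numbers in the exponents do not truncate: \<open>c(B) \<ge> c(E)\<close> and
  \<open>|B| + c(B) \<ge> |V|\<close>, and a matching with \<open>k\<close> edges covers \<open>2k\<close> vertices because loops are not
  allowed in matchings.
\<close>

definition tutte :: "('v, 'e) mgraph \<Rightarrow> 'a::comm_ring_1 \<Rightarrow> 'a \<Rightarrow> 'a" where
  "tutte G x y = (\<Sum>B \<in> Pow (edges G).
     (x - 1) ^ (num_components G B - num_components G (edges G)) *
     (y - 1) ^ (card B + num_components G B - card (verts G)))"

definition is_matching :: "('v, 'e) mgraph \<Rightarrow> 'e set \<Rightarrow> bool" where
  "is_matching G M \<longleftrightarrow> M \<subseteq> edges G \<and> (\<forall>e \<in> M. card (ends G e) = 2) \<and>
     (\<forall>d \<in> M. \<forall>e \<in> M. d \<noteq> e \<longrightarrow> ends G d \<inter> ends G e = {})"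

definition matching_poly :: "('v, 'e) mgraph \<Rightarrow> 'a::comm_ring_1 \<Rightarrow> 'a \<Rightarrow> 'a" where
  "matching_poly G w1 w2 = (\<Sum>k \<le> card (edges G).
     of_nat (card {M. is_matching G M \<and> card M = k}) * w1 ^ (card (verts G) - 2 * k) * w2 ^ k)"

text \<open>Sanity checks: the operations produce graphs, and \<^const>\<open>acyclic_poly\<close> is a graph parameter.\<close>

lemma graph_delete_edge: "graph G \<Longrightarrow> graph (delete_edge G e)"
  by (auto simp: graph_def delete_edge_def)

lemma graph_extract_edge: "graph G \<Longrightarrow> graph (extract_edge G e)"
  by (auto simp: graph_def extract_edge_def)

lemma graph_contract_edge:
  assumes "graph G"
  shows "graph (contract_edge G e)"
proof -
  have "card (h ` ends G d) \<in> {1, 2}" if "d \<in> edges G" for h :: "'a \<Rightarrow> 'a" and d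
  proof -
    have c: "card (ends G d) \<in> {1, 2}" and "finite (ends G d)"
      using assms that by (auto simp: graph_def intro: finite_subset)
    moreover from c have "ends G d \<noteq> {}"
      by auto
    ultimately have "card (h ` ends G d) \<le> card (ends G d)" "card (h ` ends G d) \<noteq> 0"
      by (auto simp: card_image_le)
    with c show ?thesis by auto
  qed
  moreover have "h ` ends G d \<subseteq> h ` verts G" if "d \<in> edges G" for h :: "'a \<Rightarrow> 'a" and d
    using assms that by (simp add: graph_def image_mono)
  moreover have "finite (verts G)" "finite (edges G)"
    using assms by (simp_all add: graph_def)
  ultimately show ?thesis
    by (simp only: graph_def contract_edge_def Let_def mgraph.simps finite_imageI finite_Diff)
      (intro conjI ballI TrueI; simp only: Diff_iff)
qed

lemma contract_loop:
  assumes "graph G" and "e \<in> edges G" and "card (ends G e) = 1"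
  shows "contract_edge G e = delete_edge G e"
proof -
  obtain v where v: "ends G e = {v}"
    using assms by (auto simp: card_1_singleton_iff)
  have "(\<lambda>w. if w \<in> ends G e then Min (ends G e) else w) = id"
    by (auto simp: v)
  then show ?thesis
    by (simp add: contract_edge_def delete_edge_def)
qed

lemma graph_graph_union:
  "graph G \<Longrightarrow> graph H \<Longrightarrow> graph (graph_union G H)"
  by (auto simp: graph_def graph_union_def)

lemma graph_induced: "graph G \<Longrightarrow> graph (induced G S)"
  by (auto simp: graph_def induced_def)

lemma graph_iso_sym:
  assumes "graph G" and "graph_iso G H"
  shows "graph_iso H G"
proof -
  obtain f g where f: "bij_betw f (verts G) (verts H)" and g: "bij_betw g (edges G) (edges H)"
    and fg: "\<And>e. e \<in> edges G \<Longrightarrow> ends H (g e) = f ` ends G e"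
    using assms(2) by (auto simp: graph_iso_def)
  let ?f = "inv_into (verts G) f" and ?g = "inv_into (edges G) g"
  have "ends G (?g d) = ?f ` ends H d" if "d \<in> edges H" for d
  proof -
    have "d \<in> g ` edges G"
      using that by (simp only: bij_betw_imp_surj_on[OF g])
    then obtain e where e: "d = g e" "e \<in> edges G" ..
    have "ends G e \<subseteq> verts G"
      using assms(1) e by (auto simp: graph_def)
    with e show ?thesis
      by (simp add: fg inv_into_image_cancel[OF bij_betw_imp_inj_on[OF f]]
          inv_into_f_f[OF bij_betw_imp_inj_on[OF g]])
  qed
  with bij_betw_inv_into[OF f] bij_betw_inv_into[OF g] show ?thesis
    unfolding graph_iso_def by blast
qed

lemma acyclic_graph_iso:
  assumes "graph G" and "graph_iso G H" and "acyclic_graph H"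
  shows "acyclic_graph G"
  unfolding acyclic_graph_def
proof
  assume "\<exists>vs es. is_cycle G vs es"
  then obtain vs es where c: "is_cycle G vs es" by blast
  obtain f g where f: "bij_betw f (verts G) (verts H)" and g: "bij_betw g (edges G) (edges H)"
    and fg: "\<And>e. e \<in> edges G \<Longrightarrow> ends H (g e) = f ` ends G e"
    using assms(2) by (auto simp: graph_iso_def)
  have "ends H (map g es ! i) = {map f vs ! i, map f vs ! (Suc i mod length vs)}"
    if "i < length vs" for i
  proof -
    have "Suc i mod length vs < length vs"
      using that by (intro mod_less_divisor) auto
    moreover have "es ! i \<in> edges G"
      using c that unfolding is_cycle_def by (metis nth_mem subsetD)
    ultimately show ?thesis
      using c that fg by (auto simp: is_cycle_def)
  qed
  moreover have "distinct (map f vs)" "distinct (map g es)"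
    using c f g by (auto simp: is_cycle_def distinct_map bij_betw_def intro: inj_on_subset)
  moreover have "set (map f vs) \<subseteq> verts H" "set (map g es) \<subseteq> edges H"
    using c bij_betw_imp_surj_on[OF f] bij_betw_imp_surj_on[OF g]
    unfolding is_cycle_def by (metis image_mono set_map)+
  ultimately have "is_cycle H (map f vs) (map g es)"
    using c by (auto simp: is_cycle_def)
  with assms(3) show False
    by (auto simp: acyclic_graph_def)
qed

lemma acyclic_poly_iso:
  assumes "graph G" and "graph H" and "graph_iso G H"
  shows "acyclic_poly G = acyclic_poly H"
proof -
  obtain f g where f: "bij_betw f (verts G) (verts H)" and g: "bij_betw g (edges G) (edges H)"
    and fg: "\<And>e. e \<in> edges G \<Longrightarrow> ends H (g e) = f ` ends G e"
    using assms(3) by (auto simp: graph_iso_def)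
  have injf: "inj_on f (verts G)" and imf: "f ` verts G = verts H"
    using f by (auto simp: bij_betw_def)
  have iso: "graph_iso (induced G S) (induced H (f ` S))" if S: "S \<subseteq> verts G" for S
  proof -
    have "bij_betw f (verts (induced G S)) (verts (induced H (f ` S)))"
    proof -
      have "verts G \<inter> S = S" "verts H \<inter> f ` S = f ` S"
        using S imf by auto
      then show ?thesis
        using injf S by (auto simp: induced_def bij_betw_def intro: inj_on_subset)
    qed
    moreover have "ends H (g e) \<subseteq> f ` S \<longleftrightarrow> ends G e \<subseteq> S" if "e \<in> edges G" for e
    proof -
      have "ends G e \<subseteq> verts G"
        using assms(1) that by (auto simp: graph_def)
      then show ?thesis
        using inj_on_image_mem_iff[OF injf _ S] fg[OF that]
        by (simp only: image_subset_iff) (meson subsetD subsetI)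
    qed
    then have "edges (induced H (f ` S)) = g ` edges (induced G S)"
      using bij_betw_imp_surj_on[OF g, symmetric] by (auto simp: induced_def)
    then have "bij_betw g (edges (induced G S)) (edges (induced H (f ` S)))"
      using g by (auto simp: bij_betw_def induced_def intro: inj_on_subset)
    ultimately show ?thesis
      using fg unfolding graph_iso_def
      by (intro exI[of _ f] exI[of _ g] conjI) (auto simp: induced_def)
  qed
  have acyc: "acyclic_graph (induced G S) \<longleftrightarrow> acyclic_graph (induced H (f ` S))"
    if "S \<subseteq> verts G" for S
    using iso[OF that] assms by (meson acyclic_graph_iso graph_induced graph_iso_sym)
  have "card (acyclic_sets G i) = card (acyclic_sets H i)" for i
  proof (rule bij_betw_same_card)
    show "bij_betw ((`) f) (acyclic_sets G i) (acyclic_sets H i)"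
      unfolding bij_betw_def
    proof
      show "inj_on ((`) f) (acyclic_sets G i)"
        by (rule inj_on_subset[OF inj_on_image_Pow[OF injf]]) (auto simp: acyclic_sets_def)
      have card: "card (f ` S) = card S" if "S \<subseteq> verts G" for S
        using that injf by (auto intro: card_image inj_on_subset)
      have mem: "f ` S \<in> acyclic_sets H i \<longleftrightarrow> S \<in> acyclic_sets G i" if "S \<subseteq> verts G" for S
      proof -
        have "f ` S \<subseteq> verts H"
          using that imf by blast
        then show ?thesis
          using that card[OF that] acyc[OF that] by (simp add: acyclic_sets_def)
      qed
      show "(`) f ` acyclic_sets G i = acyclic_sets H i"
      proof
        show "(`) f ` acyclic_sets G i \<subseteq> acyclic_sets H i"
          using mem by (auto simp only: acyclic_sets_def image_subset_iff mem_Collect_eq)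
        show "acyclic_sets H i \<subseteq> (`) f ` acyclic_sets G i"
        proof
          fix T
          assume T: "T \<in> acyclic_sets H i"
          then have "T \<subseteq> f ` verts G"
            by (simp add: acyclic_sets_def imf)
          then obtain S where "S \<subseteq> verts G" "T = f ` S"
            by (rule subset_imageE)
          with T mem show "T \<in> (`) f ` acyclic_sets G i"
            by blast
        qed
      qed
    qed
  qed
  moreover have "card (verts G) = card (verts H)"
    using f by (rule bij_betw_same_card)
  ultimately show ?thesis
    by (simp add: acyclic_poly_def)
qed

lemma graph_parameter_acyclic_poly: "graph_parameter (\<lambda>G. \<phi> (acyclic_poly G))"
  unfolding graph_parameter_def by (intro allI impI arg_cong[of _ _ \<phi>] acyclic_poly_iso)

end

theory Submission
  imports Defs
begin

text \<open>
  Loops decide everything. Adding a loop at an isolated vertex forbids that vertex, while adding an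
  edge between two isolated vertices leaves every vertex set acyclic. An EE-invariant cannot tell
  these two changes apart: both edges contract to a single vertex and extract to the graph without
  vertices, so the value changes by the same amount \<open>\<alpha> * \<gamma> + \<beta>\<close> (lemma
  \<open>EE_invariant_one_edge\<close>). For the acyclic polynomial the change is \<open>-x\<close> in the first case and
  \<open>0\<close> in the second.

  For the two polynomials a single vertex suffices, without any recurrence. The Tutte polynomial
  of an edgeless graph is \<open>1\<close>, against the acyclic polynomial \<open>1 + x\<close>. The matching polynomial
  does not see loops, whereas a loop at the vertex turns the acyclic polynomial from \<open>1 + x\<close>
  into \<open>1\<close>.
\<close>

lemma acyclic_graph_induced:
  assumes "acyclic_graph G"
  shows "acyclic_graph (induced G S)"
proof -
  have "is_cycle G vs es" if "is_cycle (induced G S) vs es" for vs es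
    using that by (auto simp: is_cycle_def induced_def)
  with assms show ?thesis
    by (auto simp: acyclic_graph_def)
qed

text \<open>In a forest every vertex set counts, and the sum is the binomial expansion.\<close>

lemma acyclic_poly_forest:
  assumes "graph G" and "acyclic_graph G"
  shows "acyclic_poly G = [:1, 1:] ^ card (verts G)"
proof -
  have fin: "finite (verts G)"
    using assms(1) by (simp add: graph_def)
  have "acyclic_sets G i = {S. S \<subseteq> verts G \<and> card S = i}" for i
    using acyclic_graph_induced[OF assms(2)] by (auto simp: acyclic_sets_def)
  then have "card (acyclic_sets G i) = card (verts G) choose i" for i
    by (simp add: n_subsets[OF fin])
  then have "acyclic_poly G = (\<Sum>i \<le> card (verts G). monom (int (card (verts G) choose i)) i)"
    by (simp add: acyclic_poly_def)
  also have "\<dots> = (\<Sum>i \<le> card (verts G). of_nat (card (verts G) choose i) * monom 1 1 ^ i)"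
    by (simp add: of_nat_poly monom_power smult_monom)
  also have "\<dots> = (monom 1 1 + 1) ^ card (verts G)"
    by (simp add: binomial_ring)
  also have "monom 1 1 + 1 = [:1, 1 :: int:]"
    by (simp add: monom_Suc monom_0 one_pCons)
  finally show ?thesis .
qed

text \<open>A vertex with a loop lies in no acyclic set, so here only the empty set is left.\<close>

lemma acyclic_poly_loop_at_every_vertex:
  assumes "\<And>v. v \<in> verts G \<Longrightarrow> \<exists>e \<in> edges G. ends G e = {v}"
  shows "acyclic_poly G = 1"
proof -
  have "S = {}" if S: "S \<subseteq> verts G" and acyc: "acyclic_graph (induced G S)" for S
  proof (rule ccontr)
    assume "S \<noteq> {}"
    then obtain v where "v \<in> S" by blast
    with S assms obtain e where "e \<in> edges G" "ends G e = {v}" by blast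
    with \<open>v \<in> S\<close> S have "is_cycle (induced G S) [v] [e]"
      by (auto simp: is_cycle_def induced_def)
    with acyc show False
      by (auto simp: acyclic_graph_def)
  qed
  moreover have "acyclic_graph (induced G {})"
    by (auto simp: acyclic_graph_def is_cycle_def induced_def)
  ultimately have iff: "S \<subseteq> verts G \<and> acyclic_graph (induced G S) \<longleftrightarrow> S = {}" for S
    by blast
  have "acyclic_sets G i = {S. (S \<subseteq> verts G \<and> acyclic_graph (induced G S)) \<and> card S = i}" for i
    by (auto simp: acyclic_sets_def)
  then have "acyclic_sets G i = (if i = 0 then {{}} else {})" for i
    by (auto simp: iff)
  then have "acyclic_poly G = (\<Sum>i \<le> card (verts G). if i = 0 then 1 else 0)"
    unfolding acyclic_poly_def by (intro sum.cong) (auto simp: monom_0)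
  then show ?thesis
    by simp
qed

text \<open>
  The value \<open>V\<close> of \<^const>\<open>ends\<close> is chosen so that deleting the edge of \<open>one_edge u v\<close> below
  yields this very record, not only an isomorphic graph.
\<close>

definition edgeless :: "nat set \<Rightarrow> (nat, nat) mgraph" where
  "edgeless V = \<lparr>verts = V, edges = {}, ends = (\<lambda>_. V)\<rparr>"

text \<open>A single vertex with a loop if \<open>u = v\<close>, and the complete graph on two vertices otherwise.\<close>

definition one_edge :: "nat \<Rightarrow> nat \<Rightarrow> (nat, nat) mgraph" where
  "one_edge u v = \<lparr>verts = {u, v}, edges = {0}, ends = (\<lambda>_. {u, v})\<rparr>"

lemma graph_edgeless: "finite V \<Longrightarrow> graph (edgeless V)"
  by (simp add: graph_def edgeless_def)

lemma graph_one_edge: "graph (one_edge u v)"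
  by (auto simp: graph_def one_edge_def card_insert_if)

lemma acyclic_poly_edgeless:
  assumes "finite V"
  shows "acyclic_poly (edgeless V) = [:1, 1:] ^ card V"
proof -
  have "acyclic_graph (edgeless V)"
    by (auto simp: acyclic_graph_def is_cycle_def edgeless_def)
  then show ?thesis
    using acyclic_poly_forest[OF graph_edgeless[OF assms]] by (simp add: edgeless_def)
qed

lemma acyclic_poly_K2:
  assumes "u \<noteq> v"
  shows "acyclic_poly (one_edge u v) = [:1, 1:] ^ 2"
proof -
  have "\<not> is_cycle (one_edge u v) vs es" for vs es
  proof
    assume c: "is_cycle (one_edge u v) vs es"
    then have es: "distinct es" "set es \<subseteq> {0}" "es \<noteq> []"
      and len: "length es = length vs"
      by (auto simp: is_cycle_def one_edge_def)
    have "length es = card (set es)"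
      using es(1) by (simp add: distinct_card)
    also have "\<dots> \<le> 1"
      using card_mono[OF _ es(2)] by simp
    finally have "length vs = 1"
      using es(3) len by (cases es) auto
    with c have "{u, v} = {vs ! 0}"
      by (auto simp: is_cycle_def one_edge_def)
    with assms show False
      by auto
  qed
  then have "acyclic_graph (one_edge u v)"
    by (simp add: acyclic_graph_def)
  moreover have "card (verts (one_edge u v)) = 2"
    using assms by (simp add: one_edge_def)
  ultimately show ?thesis
    by (simp add: acyclic_poly_forest[OF graph_one_edge])
qed

lemma acyclic_poly_loop: "acyclic_poly (one_edge v v) = 1"
  by (rule acyclic_poly_loop_at_every_vertex) (simp add: one_edge_def)

text \<open>
  The amount \<open>c\<close> is \<open>\<alpha> * \<gamma> + \<beta>\<close>; it does not depend on whether the edge is a loop.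
\<close>

lemma EE_invariant_one_edge:
  assumes "EE_invariant F"
  obtains c where "\<And>u v. F (one_edge u v) = F (edgeless {u, v}) + c"
proof -
  obtain \<alpha> \<beta> \<gamma> where rec: "\<And>G e. graph G \<Longrightarrow> e \<in> edges G \<Longrightarrow>
      F G = F (delete_edge G e) + \<alpha> * F (contract_edge G e) + \<beta> * F (extract_edge G e)"
    and empty: "\<And>G. graph G \<Longrightarrow> verts G = {} \<Longrightarrow> F G = 1"
    and single: "\<And>G. graph G \<Longrightarrow> card (verts G) = 1 \<Longrightarrow> edges G = {} \<Longrightarrow> F G = \<gamma>"
    using assms unfolding EE_invariant_def by metis
  have "F (one_edge u v) = F (edgeless {u, v}) + (\<alpha> * \<gamma> + \<beta>)" for u v
  proof -
    let ?G = "one_edge u v"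
    have "delete_edge ?G 0 = edgeless {u, v}"
      by (simp add: delete_edge_def one_edge_def edgeless_def)
    moreover have "F (contract_edge ?G 0) = \<gamma>"
      by (rule single[OF graph_contract_edge[OF graph_one_edge]])
        (simp_all add: contract_edge_def one_edge_def)
    moreover have "F (extract_edge ?G 0) = 1"
      by (rule empty[OF graph_extract_edge[OF graph_one_edge]])
        (simp add: extract_edge_def one_edge_def)
    ultimately show ?thesis
      using rec[OF graph_one_edge, of 0 u v] by (simp add: one_edge_def add.assoc)
  qed
  then show thesis
    by (rule that)
qed

lemma tutte_edgeless:
  assumes "finite V"
  shows "tutte (edgeless V) p q = 1"
proof -
  have "num_components (edgeless V) {} \<le> card V"
    using card_image_le[OF assms, of "\<lambda>v. connected_rel (edgeless V) {} `` {v}"]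
    by (simp add: num_components_def quotient_def edgeless_def UNION_singleton_eq_range)
  then show ?thesis
    by (simp add: tutte_def edgeless_def)
qed

lemma matching_poly_only_loops:
  assumes "\<And>e. e \<in> edges G \<Longrightarrow> card (ends G e) = 1"
  shows "matching_poly G w1 w2 = w1 ^ card (verts G)"
proof -
  have "M = {}" if "is_matching G M" for M
  proof (rule ccontr)
    assume "M \<noteq> {}"
    then obtain e where "e \<in> M" by blast
    with that have "e \<in> edges G" "card (ends G e) = 2"
      by (auto simp: is_matching_def)
    with assms show False
      by simp
  qed
  moreover have "is_matching G {}"
    by (simp add: is_matching_def)
  ultimately have iff: "is_matching G M \<longleftrightarrow> M = {}" for M
    by blast
  have "{M. is_matching G M \<and> card M = k} = (if k = 0 then {{}} else {})" for k
    by (auto simp: iff)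
  then have "matching_poly G w1 w2 =
      (\<Sum>k \<le> card (edges G). if k = 0 then w1 ^ card (verts G) else 0)"
    unfolding matching_poly_def by (intro sum.cong) auto
  then show ?thesis
    by simp
qed

theorem theorem1p9:
  fixes \<phi> :: "int poly \<Rightarrow> 'r::comm_ring_1"
  assumes "inj \<phi>"
    and "\<phi> 1 = 1"
    and "\<And>f g. \<phi> (f + g) = \<phi> f + \<phi> g"
    and "\<And>f g. \<phi> (f * g) = \<phi> f * \<phi> g"
  shows "\<not> EE_invariant (\<lambda>G. \<phi> (acyclic_poly G)) \<and>
    \<not> (\<exists>p q. \<forall>G :: (nat, nat) mgraph. graph G \<longrightarrow> \<phi> (acyclic_poly G) = tutte G p q) \<and>
    \<not> (\<exists>w1 w2. \<forall>G :: (nat, nat) mgraph. graph G \<longrightarrow> \<phi> (acyclic_poly G) = matching_poly G w1 w2)"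
proof -
  have ne: "\<phi> [:1, 1:] \<noteq> \<phi> 1"
    using assms(1) by (simp add: inj_eq one_pCons)
  have K1: "acyclic_poly (edgeless {0}) = [:1, 1:]"
    by (simp add: acyclic_poly_edgeless)
  have "\<not> EE_invariant (\<lambda>G. \<phi> (acyclic_poly G))"
  proof
    assume "EE_invariant (\<lambda>G. \<phi> (acyclic_poly G))"
    then obtain c where c: "\<And>u v.
        \<phi> (acyclic_poly (one_edge u v)) = \<phi> (acyclic_poly (edgeless {u, v})) + c"
      by (rule EE_invariant_one_edge) blast
    have "acyclic_poly (one_edge 0 1) = acyclic_poly (edgeless {0, 1})"
      by (simp add: acyclic_poly_K2 acyclic_poly_edgeless power2_eq_square)
    with c[of 0 1] have "c = 0"
      by simp
    with c[of 0 0] ne show False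
      by (simp add: acyclic_poly_loop K1)
  qed
  moreover have False if "\<And>G :: (nat, nat) mgraph. graph G \<Longrightarrow> \<phi> (acyclic_poly G) = tutte G p q"
    for p q
    using that[OF graph_edgeless, of "{0}"] ne assms(2) by (simp add: K1 tutte_edgeless)
  moreover have False
    if M: "\<And>G :: (nat, nat) mgraph. graph G \<Longrightarrow> \<phi> (acyclic_poly G) = matching_poly G w1 w2"
    for w1 w2
  proof -
    have "\<phi> [:1, 1:] = matching_poly (edgeless {0}) w1 w2"
      using M[OF graph_edgeless, of "{0}"] by (simp add: K1)
    also have "\<dots> = matching_poly (one_edge 0 0) w1 w2"
      by (simp add: matching_poly_only_loops edgeless_def one_edge_def)
    also have "\<dots> = \<phi> 1"
      using M[OF graph_one_edge, of 0 0] by (simp add: acyclic_poly_loop)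
    finally show False
      using ne by simp
  qed
  ultimately show ?thesis
    by blast
qed

end
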